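(* The polynomials $\mathcal{J}_p^m$ and $\mathcal{J}_p^{-m-2}$ defined in the context satisfy the following. (1) For $m\ge -1$, $p\ge 2m+2$: $(\mathcal{J}_p^m)^{(k)}(\pm1)=0$ for $k=0,1,\ldots,m$. (2) For $m\ge 0$, $p\ge 2m+2$: $(\mathcal{J}_{p-2m-1}^{-m-1})'(\mu)=(p-2m-1)\,\mathcal{J}_{p-2m-2}^{-m-2}(\mu)$. (3) For $m\ge 0$, $p\ge 2m+2$: $\mathcal{J}_p^m(\mu)=p\int_{-1}^{\mu}\mathcal{J}_{p-1}^{m-1}(s)\,ds$. (4) For $m\ge 0$, $p\ge 2m+2$: $$\mathcal{J}_p^m(\mu)=\mathcal{J}_p^{m-1}(\mu)-\frac{p(p-1)}{(2p-2m-1)(2p-2m-3)}\mathcal{J}_{p-2}^{m-1}(\mu).$$ (5) For $m\ge -1$, $p\ge 0$, with $2\alpha=2m+3$: $$\mathcal{J}_p^{-m-2}(\mu)=\frac{(2\alpha-1)!\,p!\,2^{p-1}\,\big((2p+2\alpha-3)/2\big)!}{(2p+2\alpha-2)!\,\big((2\alpha-1)/2\big)!}\,C_p^{(\alpha)}(\mu).$$ (6) For every integer $m$, the three-term recurrence $$\mathcal{J}_p^m(\mu)=\mu\,\mathcal{J}_{p-1}^m(\mu)-\frac{(p-1)(p-2m-3)}{(2p-2m-3)(2p-2m-5)}\,\mathcal{J}_{p-2}^m(\mu),\quad p\ge 2,\qquad \mathcal{J}_0^m(\mu)=1,\ \mathcal{J}_1^m(\mu)=\mu,$$ holds. That is,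 for each integer $m$, the sequence generated by this recurrence from the two starting values $1$ and $\mu$ coincides with the explicitly defined $\mathcal{J}_p^m$ at every index $p$ for which $\mathcal{J}_p^m$ is explicitly defined (all $p\ge 0$ if $m\le -1$; all $p\ge 2m+2$ if $m\ge 0$). (7) For $m\ge -1$ and $p,q\ge 2m+2$: $$\int_{-1}^1\frac{\mathcal{J}_p^m(\mu)\,\mathcal{J}_q^m(\mu)}{(1-\mu^2)^{m+1}}\,d\mu=\begin{cases}0 & p\ne q,\\[4pt] \dfrac{2^{2p-2m-3}\big((p-m-2)!\big)^2(p-2m-2)!\,p!}{(2p-2m-1)\big((2p-2m-3)!\big)^2} & p=q.\end{cases}$$
   Context: $P_n$ is the Legendre polynomial of degree $n$ (normalized by $P_n(1)=1$), $C_p^{(\alpha)}$ is the standard ultraspherical (Gegenbauer) polynomial of degree $p$, superscripts $(k)$ on functions are derivatives, and $\mu\in[-1,1]$. For integers $m\ge -1$, $p\ge 2m+2$ define $$J_{m,p}=\frac{2^{p-m-2}(p-m-2)!\,(p-2m-2)!}{(2p-2m-3)!},\qquad \mathcal{J}_p^m(\mu)=J_{m,p}\,(\mu^2-1)^{m+1}P_{p-m-1}^{(m+1)}(\mu).$$ The constant $J_{m,p}$ is chosen so that $\mathcal{J}_p^m$ is monic. For integers $m\ge -1$, $q\ge 0$ define $$\mathcal{J}_q^{-m-2}(\mu)=J_{m,q+2m+2}\,P_{q+m+1}^{(m+1)}(\mu),$$ so that $\mathcal{J}_p^m(\mu)=(\mu^2-1)^{m+1}\mathcal{J}_{p-2m-2}^{-m-2}(\mu)$.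 For $m=-1$ the two definitions agree and $\mathcal{J}_p^{-1}$ is the monic Legendre polynomial. In the degenerate case where a quotient of the form $(n-1)!/(2n-1)!$ occurs with $n=0$ (only for $m=-1$, $p=0$), it is read as $2\,n!/(2n)!=2$; in particular $J_{-1,0}=1$. For $m\ge 0$ and $0\le p<2m+2$, $\mathcal{J}_p^m$ is understood as the polynomial generated by the recurrence in (6). *)

theory Defs
  imports "HOL-Analysis.Analysis" "HOL-Computational_Algebra.Polynomial"
begin

text \<open>Rodrigues' formula; the normalization \<open>P\<^sub>n(1) = 1\<close> is \<open>poly_legendre_1\<close> below.\<close>
definition legendre :: "nat \<Rightarrow> real poly" where
  "legendre n = smult (1 / (2 ^ n * fact n)) ((pderiv ^^ n) ([:-1, 0, 1:] ^ n))"

text \<open>The usual explicit sum for the ultraspherical polynomials,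
  \<open>\<Sum>k\<le>n/2. (-1)^k (\<alpha>)\<^sub>n\<^sub>-\<^sub>k / (k! (n-2k)!) (2x)^(n-2k)\<close>,
  that is, the coefficient of \<open>t^n\<close> in \<open>(1 - 2xt + t^2)^(-\<alpha>)\<close>.\<close>
definition gegenbauer :: "real \<Rightarrow> nat \<Rightarrow> real poly" where
  "gegenbauer \<alpha> n =
     (\<Sum>k\<le>n div 2. smult ((-1) ^ k * pochhammer \<alpha> (n - k) / (fact k * fact (n - 2 * k)))
                          ([:0, 2:] ^ (n - 2 * k)))"

text \<open>Factorials and quotients of factorials with integer arguments. Arguments of \<open>ifact\<close> are
  nonnegative wherever it is used. A quotient \<open>(n-1)! / (2n-1)!\<close> with \<open>n = 0\<close> is read as
  \<open>2 n! / (2n)! = 2\<close>.\<close>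
definition ifact :: "int \<Rightarrow> real" where
  "ifact i = fact (nat i)"

definition fact_quot :: "int \<Rightarrow> int \<Rightarrow> real" where
  "fact_quot i j = (if i = -1 \<and> j = -1 then 2 else ifact i / ifact j)"

definition J_const :: "int \<Rightarrow> nat \<Rightarrow> real" where
  "J_const m p = 2 powi (int p - m - 2) * ifact (int p - 2 * m - 2)
                 * fact_quot (int p - m - 2) (2 * int p - 2 * m - 3)"

text \<open>\<open>J_upper m p\<close> is the explicit polynomial with superscript \<open>m\<close>, for \<open>m \<ge> -1\<close> and
  \<open>p \<ge> 2m+2\<close>; \<open>J_lower m q\<close> is the explicit polynomial with superscript \<open>-m-2\<close>, for
  \<open>m \<ge> -1\<close> and \<open>q \<ge> 0\<close>.\<close>
definition J_upper :: "int \<Rightarrow> nat \<Rightarrow> real poly" where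
  "J_upper m p = smult (J_const m p)
     ([:-1, 0, 1:] ^ nat (m + 1) * (pderiv ^^ nat (m + 1)) (legendre (nat (int p - m - 1))))"

definition J_lower :: "int \<Rightarrow> nat \<Rightarrow> real poly" where
  "J_lower m q = smult (J_const m (nat (int q + 2 * m + 2)))
     ((pderiv ^^ nat (m + 1)) (legendre (nat (int q + m + 1))))"

definition rec_coeff :: "int \<Rightarrow> nat \<Rightarrow> real" where
  "rec_coeff m p = of_int ((int p - 1) * (int p - 2 * m - 3))
                 / of_int ((2 * int p - 2 * m - 3) * (2 * int p - 2 * m - 5))"

fun J_rec :: "int \<Rightarrow> nat \<Rightarrow> real poly" where
  "J_rec m 0 = 1"
| "J_rec m (Suc 0) = [:0, 1:]"
| "J_rec m (Suc (Suc n)) =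
     [:0, 1:] * J_rec m (Suc n) - smult (rec_coeff m (Suc (Suc n))) (J_rec m n)"

definition J_explicit_index :: "int \<Rightarrow> nat \<Rightarrow> bool" where
  "J_explicit_index m p \<longleftrightarrow> m \<le> -1 \<or> 2 * m + 2 \<le> int p"

text \<open>At \<open>m = -1\<close> both explicit definitions apply; they agree by \<open>J_upper_eq_J_lower\<close>.\<close>
definition J :: "int \<Rightarrow> nat \<Rightarrow> real poly" where
  "J m p = (if m \<le> -2 then J_lower (- m - 2) p
            else if 2 * m + 2 \<le> int p then J_upper m p
            else J_rec m p)"

lemma J_upper_eq_J_lower: "J_upper (-1) p = J_lower (-1) p"
  by (simp add: J_upper_def J_lower_def)

lemma J_const_degenerate: "J_const (-1) 0 = 1"
  by (simp add: J_const_def fact_quot_def ifact_def power_int_def)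

lemma J_upper_factor:
  assumes "m \<ge> -1" and "2 * m + 2 \<le> int p"
  shows "J_upper m p = [:-1, 0, 1:] ^ nat (m + 1) * J_lower m (nat (int p - 2 * m - 2))"
proof -
  have "nat (int (nat (int p - 2 * m - 2)) + 2 * m + 2) = p"
    and "int (nat (int p - 2 * m - 2)) + m + 1 = int p - m - 1"
    using assms by auto
  then show ?thesis
    by (simp only: J_upper_def J_lower_def mult_smult_right)
qed

lemma poly_funpow_pderiv_power_mult:
  fixes g :: "real poly"
  shows "poly ((pderiv ^^ n) ([:-a, 1:] ^ n * g)) a = fact n * poly g a"
proof (induction n arbitrary: g)
  case (Suc n)
  have "pderiv ([:-a, 1:] ^ Suc n * g) =
        [:-a, 1:] ^ n * (smult (of_nat (Suc n)) g + [:-a, 1:] * pderiv g)"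
    by (simp only: pderiv_mult pderiv_power_Suc) (simp add: pderiv_pCons algebra_simps)
  then show ?case
    using Suc.IH by (simp add: funpow_Suc_right del: funpow.simps power_Suc)
qed simp

lemma poly_legendre_1: "poly (legendre n) 1 = 1"
proof -
  have "([:-1, 0, 1:] :: real poly) = [:-1, 1:] * [:1, 1:]"
    by simp
  then have "(pderiv ^^ n) ([:-1, 0, 1:] ^ n :: real poly) =
             (pderiv ^^ n) ([:-1, 1:] ^ n * [:1, 1:] ^ n)"
    by (simp only: power_mult_distrib)
  then show ?thesis
    by (simp add: legendre_def poly_funpow_pderiv_power_mult poly_power)
qed

end

theory Submission
  imports Defs
begin

text \<open>All the polynomials are monic ultraspherical: with \<open>G\<^sub>\<alpha>\<^sub>,\<^sub>p\<close> generated by the monic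
  ultraspherical recurrence, the polynomial with superscript \<open>m\<close> and degree \<open>p\<close> is
  \<open>G\<^sub>\<alpha>\<^sub>,\<^sub>p\<close> with \<open>\<alpha> = -m - 1/2\<close>, for every integer \<open>m\<close>. For \<open>\<alpha>\<close> outside the nonpositive
  integers the recurrence alone gives, by induction on the degree, the contiguity relation (4),
  the derivative rule \<open>G\<^sub>\<alpha>\<^sub>,\<^sub>p' = p G\<^sub>\<alpha>\<^sub>+\<^sub>1\<^sub>,\<^sub>p\<^sub>-\<^sub>1\<close> and a formula for
  \<open>(x\<^sup>2 - 1) G\<^sub>\<alpha>\<^sub>+\<^sub>1\<^sub>,\<^sub>p\<close>. The last one yields \<open>G\<^sub>1\<^sub>/\<^sub>2\<^sub>-\<^sub>M\<^sub>,\<^sub>2\<^sub>M = (x\<^sup>2 - 1)\<^sup>M\<close>,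
  whose \<open>M\<close>-th derivative is Rodrigues' formula, and since the recurrence coefficients of
  \<open>G\<^sub>1\<^sub>/\<^sub>2\<^sub>-\<^sub>M\<close> at index \<open>n + 2M\<close> and of \<open>G\<^sub>1\<^sub>/\<^sub>2\<^sub>+\<^sub>M\<close> at index \<open>n\<close> coincide, the factorization
  \<open>G\<^sub>1\<^sub>/\<^sub>2\<^sub>-\<^sub>M\<^sub>,\<^sub>n\<^sub>+\<^sub>2\<^sub>M = (x\<^sup>2 - 1)\<^sup>M G\<^sub>1\<^sub>/\<^sub>2\<^sub>+\<^sub>M\<^sub>,\<^sub>n\<close>. Integration by parts trades
  \<open>(M, n)\<close> for \<open>(M + 1, n - 1)\<close> in the inner products, which gives orthogonality and reduces the
  norms to \<open>\<integral>(x\<^sup>2 - 1)\<^sup>M\<close>, itself obtained from (4) and orthogonality.\<close>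

section \<open>Monic ultraspherical polynomials and admissible parameters\<close>

definition ultra_coeff :: "real \<Rightarrow> nat \<Rightarrow> real" where
  "ultra_coeff a n = (real n + 1) * (real n + 2 * a) / (4 * (real n + a) * (real n + a + 1))"

text \<open>The index of \<open>ultra_coeff\<close> is the lower of the two degrees involved. Some
  coefficient has a zero denominator exactly when \<open>a\<close> is a nonpositive integer, which
  accounts for the hypothesis on \<open>a\<close> below; half-integers are always safe.\<close>

fun ultra :: "real \<Rightarrow> nat \<Rightarrow> real poly" where
  "ultra a 0 = 1"
| "ultra a (Suc 0) = [:0, 1:]"
| "ultra a (Suc (Suc n)) = [:0, 1:] * ultra a (Suc n) - smult (ultra_coeff a n) (ultra a n)"

lemma poly_ext:
  fixes p q :: "real poly"
  assumes "\<And>x. poly p x = poly q x"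
  shows "p = q"
  using assms poly_eq_poly_eq_iff by blast

lemma nonpos_Ints_add_nat:
  fixes a :: real
  assumes "a \<notin> \<int>\<^sub>\<le>\<^sub>0"
  shows "real n + a \<noteq> 0"
proof
  assume "real n + a = 0"
  then have "a = - of_nat n" by simp
  then show False using assms nonpos_Ints_of_int[of "- int n"] by simp
qed

lemma nonpos_Ints_add_1:
  fixes a :: real
  assumes "a \<notin> \<int>\<^sub>\<le>\<^sub>0"
  shows "a + 1 \<notin> \<int>\<^sub>\<le>\<^sub>0"
proof
  assume "a + 1 \<in> \<int>\<^sub>\<le>\<^sub>0"
  then obtain n where "a + 1 = - of_nat n" by (elim nonpos_Ints_cases')
  then show False using nonpos_Ints_add_nat[OF assms, of "Suc n"] by simp
qed

section \<open>Raising the parameter: contiguity and derivatives\<close>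

definition ultra_raise_coeff :: "real \<Rightarrow> nat \<Rightarrow> real" where
  "ultra_raise_coeff a n = (real n + 1) * (real n + 2) / (4 * (real n + a + 1) * (real n + a + 2))"

text \<open>Inserting the recurrences for \<open>a\<close> and \<open>a + 1\<close> into the
  relation of \<open>ultra_raise\<close> and comparing coefficients leaves the first two identities
  for the inductive step; the third is the case of degree 2.\<close>

lemma ultra_coeff_raise_eqs:
  assumes a: "a \<notin> \<int>\<^sub>\<le>\<^sub>0"
  shows "ultra_coeff a (n + 1) + ultra_raise_coeff a n = ultra_coeff (a + 1) (n + 1) + ultra_raise_coeff a (n + 1)"
    and "ultra_raise_coeff a (n + 1) * ultra_coeff (a + 1) n = ultra_coeff a (n + 2) * ultra_raise_coeff a n"
    and "ultra_coeff a 0 = ultra_coeff (a + 1) 0 + ultra_raise_coeff a 0"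
proof -
  have nz: "real n + a \<noteq> 0" "real n + a + 1 \<noteq> 0" "real n + a + 2 \<noteq> 0" "real n + a + 3 \<noteq> 0"
     "a \<noteq> 0" "a + 1 \<noteq> 0" "a + 2 \<noteq> 0"
    using nonpos_Ints_add_nat[OF a, of n] nonpos_Ints_add_nat[OF a, of "n + 1"]
      nonpos_Ints_add_nat[OF a, of "n + 2"] nonpos_Ints_add_nat[OF a, of "n + 3"]
      nonpos_Ints_add_nat[OF a, of 0] nonpos_Ints_add_nat[OF a, of 1] nonpos_Ints_add_nat[OF a, of 2]
    by (auto simp: algebra_simps)
  \<comment> \<open>In terms of \<open>u\<close> every denominator is a product of integer shifts of
    one variable, so clearing denominators leaves a polynomial identity.\<close>
  define u where "u = real n + a"
  have ra: "a = u - real n" by (simp add: u_def)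
  have u: "u \<noteq> 0" "u + 1 \<noteq> 0" "u + 2 \<noteq> 0" "u + 3 \<noteq> 0" using nz by (simp_all add: u_def)
  have "(real n + 2) * (real n + 1 + 2 * (u - real n)) / (4 * (u + 1) * (u + 2)) + (real n + 1) * (real n + 2) / (4 * (u + 1) * (u + 2))
     = (real n + 2) * (real n + 1 + 2 * (u - real n + 1)) / (4 * (u + 2) * (u + 3)) + (real n + 2) * (real n + 3) / (4 * (u + 2) * (u + 3))"
    using u by (simp add: divide_simps) algebra
  then show "ultra_coeff a (n + 1) + ultra_raise_coeff a n = ultra_coeff (a + 1) (n + 1) + ultra_raise_coeff a (n + 1)"
    by (simp add: ultra_coeff_def ultra_raise_coeff_def ra algebra_simps)
  show "ultra_raise_coeff a (n + 1) * ultra_coeff (a + 1) n = ultra_coeff a (n + 2) * ultra_raise_coeff a n"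
    using nz by (simp add: ultra_coeff_def ultra_raise_coeff_def add_ac divide_simps)
  show "ultra_coeff a 0 = ultra_coeff (a + 1) 0 + ultra_raise_coeff a 0"
    using nz by (simp add: ultra_coeff_def ultra_raise_coeff_def divide_simps) algebra
qed

lemma ultra_raise:
  assumes a: "a \<notin> \<int>\<^sub>\<le>\<^sub>0"
  shows "ultra a (n + 2) = ultra (a + 1) (n + 2) -
    smult (ultra_raise_coeff a n) (ultra (a + 1) n)"
proof (induction n rule: induct_nat_012)
  case 0
  show ?case
    by (rule poly_ext) (use ultra_coeff_raise_eqs(3)[OF a] in \<open>simp add: numeral_2_eq_2\<close>)
next
  case 1
  show ?case
  proof (rule poly_ext)
    fix x
    have p: "poly (ultra c (Suc 0 + 2)) x = x * (x * x - ultra_coeff c 0) - ultra_coeff c (Suc 0) * x" for c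
      by (simp add: algebra_simps)
    show "poly (ultra a (Suc 0 + 2)) x = poly (ultra (a + 1) (Suc 0 + 2)
        - smult (ultra_raise_coeff a (Suc 0)) (ultra (a + 1) (Suc 0))) x"
      unfolding poly_diff poly_smult p using ultra_coeff_raise_eqs(3)[OF a] ultra_coeff_raise_eqs(1)[OF a, of 0]
      by (simp only: add_0 One_nat_def ultra.simps poly_pCons poly_0) algebra
  qed
next
  case (ge2 n)
  show ?case
  proof (rule poly_ext)
    fix x
    have 1: "poly (ultra a (n + 2)) x = poly (ultra (a + 1) (n + 2)) x - ultra_raise_coeff a n * poly (ultra (a + 1) n) x"
      and 2: "poly (ultra a (n + 3)) x = poly (ultra (a + 1) (n + 3)) x - ultra_raise_coeff a (n + 1) * poly (ultra (a + 1) (n + 1)) x"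
      using ge2 by (simp_all add: numeral_3_eq_3)
    have 3: "poly (ultra c (k + 2)) x = x * poly (ultra c (k + 1)) x - ultra_coeff c k * poly (ultra c k) x" for c k
      by simp
    have 4: "ultra_coeff a (n + 2) + ultra_raise_coeff a (n + 1) = ultra_coeff (a + 1) (n + 2) + ultra_raise_coeff a (n + 2)"
      using ultra_coeff_raise_eqs(1)[OF a, of "n + 1"] by simp
    have "poly (ultra a (n + 4)) x =
       poly (ultra (a + 1) (n + 4)) x - ultra_raise_coeff a (n + 2) * poly (ultra (a + 1) (n + 2)) x"
      \<comment> \<open>Merging the numerals makes \<open>n + 2 + 1\<close> and \<open>n + 3\<close>
        the same index, so that \<open>algebra\<close> sees one atom for each polynomial
        value.\<close>
      using 1 2 3[of a "n + 2"] 3[of "a + 1" "n + 2"] 3[of "a + 1" n] 4 ultra_coeff_raise_eqs(2)[OF a, of n]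
      by (simp only: add.assoc one_plus_numeral numeral_plus_numeral numeral_plus_one add_num_simps num.inject) algebra
    then show "poly (ultra a (Suc (Suc n) + 2)) x = poly (ultra (a + 1) (Suc (Suc n) + 2)
        - smult (ultra_raise_coeff a (Suc (Suc n))) (ultra (a + 1) (Suc (Suc n)))) x"
      by (simp add: eval_nat_numeral)
  qed
qed

text \<open>Differentiating the recurrence produces one undifferentiated term,
  \<open>ultra a (n + 2)\<close>. Contiguity moves it to parameter \<open>a + 1\<close>, where the
  induction hypotheses have already put the other terms.\<close>

lemma pderiv_ultra:
  assumes a: "a \<notin> \<int>\<^sub>\<le>\<^sub>0"
  shows "pderiv (ultra a (Suc n)) = smult (real (Suc n)) (ultra (a + 1) n)"
proof (induction n rule: induct_nat_012)
  case 0
  show ?case by (simp add: pderiv_pCons one_pCons)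
next
  case 1
  show ?case by (simp add: pderiv_pCons pderiv_mult pderiv_diff pderiv_smult one_pCons)
next
  case (ge2 n)
  define g where "g = ultra_raise_coeff a n"
  have nz: "real n + a + 1 \<noteq> 0" "real n + a + 2 \<noteq> 0"
    using nonpos_Ints_add_nat[OF a, of "n + 1"] nonpos_Ints_add_nat[OF a, of "n + 2"]
    by (auto simp: algebra_simps)
  \<comment> \<open>This says that the coefficient of \<open>ultra (a + 1) n\<close> cancels once
    everything is expressed with parameter \<open>a + 1\<close>.\<close>
  have c: "(real n + 2) * ultra_coeff (a + 1) n = (real n + 1) * ultra_coeff a (n + 1) + g"
    using nz by (simp add: ultra_coeff_def g_def ultra_raise_coeff_def add_ac divide_simps) algebra
  show ?case
  proof (rule poly_ext)
    fix x
    have 1: "poly (pderiv (ultra a (n + 3))) x = poly (ultra a (n + 2)) x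
        + x * poly (pderiv (ultra a (n + 2))) x - ultra_coeff a (n + 1) * poly (pderiv (ultra a (n + 1))) x"
      by (simp add: numeral_3_eq_3 pderiv_mult pderiv_diff pderiv_smult pderiv_pCons)
    have 2: "poly (pderiv (ultra a (n + 2))) x = (real n + 2) * poly (ultra (a + 1) (n + 1)) x"
      using ge2(2) by simp
    have 3: "poly (pderiv (ultra a (n + 1))) x = (real n + 1) * poly (ultra (a + 1) n) x"
      using ge2(1) by simp
    have 4: "poly (ultra a (n + 2)) x = poly (ultra (a + 1) (n + 2)) x - g * poly (ultra (a + 1) n) x"
      using ultra_raise[OF a, of n] by (simp add: g_def del: ultra.simps add_2_eq_Suc')
    have 5: "poly (ultra (a + 1) (n + 2)) x = x * poly (ultra (a + 1) (n + 1)) x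
        - ultra_coeff (a + 1) n * poly (ultra (a + 1) n) x"
      by simp
    have "poly (pderiv (ultra a (n + 3))) x = (real n + 3) * poly (ultra (a + 1) (n + 2)) x"
      using 1 2 3 4 5 c by algebra
    then show "poly (pderiv (ultra a (Suc (Suc (Suc n))))) x =
        poly (smult (real (Suc (Suc (Suc n)))) (ultra (a + 1) (Suc (Suc n)))) x"
      by (simp add: numeral_3_eq_3 del: ultra.simps)
  qed
qed

lemma funpow_pderiv_ultra:
  assumes "a \<notin> \<int>\<^sub>\<le>\<^sub>0"
  shows "(pderiv ^^ k) (ultra a (n + k)) = smult (fact (n + k) / fact n) (ultra (a + real k) n)"
  using assms
proof (induction k arbitrary: a)
  case (Suc k)
  have 1: "(pderiv ^^ k) (smult c p) = smult c ((pderiv ^^ k) p)" for c and p :: "real poly"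
    by (induction k) (simp_all add: pderiv_smult)
  show ?case
    using Suc.IH[OF nonpos_Ints_add_1[OF Suc.prems]] Suc.prems
    by (simp add: funpow_Suc_right pderiv_ultra 1 add_ac del: funpow.simps ultra.simps)
qed simp

section \<open>Multiplication by the weight \<open>x^2 - 1\<close>\<close>

definition ultra_weight_coeff :: "real \<Rightarrow> nat \<Rightarrow> real" where
  "ultra_weight_coeff a n = (real n + 2 * a) * (real n + 2 * a + 1) / (4 * (real n + a) * (real n + a + 1))"

text \<open>The same comparison of coefficients, now for \<open>ultra_weight\<close>: two identities
  for the inductive step and one each for degrees 0 and 1.\<close>

lemma ultra_coeff_weight_eqs:
  assumes a: "a \<notin> \<int>\<^sub>\<le>\<^sub>0"
  shows "ultra_coeff a (n + 2) + ultra_weight_coeff a (n + 2) = ultra_coeff (a + 1) n + ultra_weight_coeff a (n + 1)"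
    and "ultra_weight_coeff a (n + 1) * ultra_coeff a n = ultra_coeff (a + 1) n * ultra_weight_coeff a n"
    and "ultra_coeff a 0 + ultra_weight_coeff a 0 = 1"
    and "ultra_coeff a 1 + ultra_weight_coeff a 1 = ultra_weight_coeff a 0"
proof -
  have nz: "real n + a \<noteq> 0" "real n + a + 1 \<noteq> 0" "real n + a + 2 \<noteq> 0" "real n + a + 3 \<noteq> 0"
     "a \<noteq> 0" "a + 1 \<noteq> 0" "a + 2 \<noteq> 0"
    using nonpos_Ints_add_nat[OF a, of n] nonpos_Ints_add_nat[OF a, of "n + 1"]
      nonpos_Ints_add_nat[OF a, of "n + 2"] nonpos_Ints_add_nat[OF a, of "n + 3"]
      nonpos_Ints_add_nat[OF a, of 0] nonpos_Ints_add_nat[OF a, of 1] nonpos_Ints_add_nat[OF a, of 2]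
    by (auto simp: algebra_simps)
  define u where "u = real n + a"
  have ra: "real n = u - a" by (simp add: u_def)
  have u: "u \<noteq> 0" "u + 1 \<noteq> 0" "u + 2 \<noteq> 0" "u + 3 \<noteq> 0" using nz by (simp_all add: u_def)
  have "(u - a + 3) * (u + a + 2) / (4 * (u + 2) * (u + 3)) + (u + a + 2) * (u + a + 3) / (4 * (u + 2) * (u + 3))
     = (u - a + 1) * (u + a + 2) / (4 * (u + 1) * (u + 2)) + (u + a + 1) * (u + a + 2) / (4 * (u + 1) * (u + 2))"
    using u by (simp add: divide_simps) algebra
  then show "ultra_coeff a (n + 2) + ultra_weight_coeff a (n + 2) = ultra_coeff (a + 1) n + ultra_weight_coeff a (n + 1)"
    by (simp add: ultra_coeff_def ultra_weight_coeff_def ra algebra_simps)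
  show "ultra_weight_coeff a (n + 1) * ultra_coeff a n = ultra_coeff (a + 1) n * ultra_weight_coeff a n"
    using nz by (simp add: ultra_coeff_def ultra_weight_coeff_def add_ac divide_simps)
  show "ultra_coeff a 0 + ultra_weight_coeff a 0 = 1"
    using nz by (simp add: ultra_coeff_def ultra_weight_coeff_def divide_simps) algebra
  show "ultra_coeff a 1 + ultra_weight_coeff a 1 = ultra_weight_coeff a 0"
    using nz by (simp add: ultra_coeff_def ultra_weight_coeff_def divide_simps add_ac) algebra
qed

lemma ultra_weight:
  assumes a: "a \<notin> \<int>\<^sub>\<le>\<^sub>0"
  shows "[:-1, 0, 1:] * ultra (a + 1) n = ultra a (n + 2) -
    smult (ultra_weight_coeff a n) (ultra a n)"
proof (induction n rule: induct_nat_012)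
  case 0
  show ?case
    by (rule poly_ext) (use ultra_coeff_weight_eqs(3)[OF a] in \<open>simp add: numeral_2_eq_2\<close>)
next
  case 1
  show ?case
  proof (rule poly_ext)
    fix x
    have p: "poly (ultra a (Suc 0 + 2)) x = x * (x * x - ultra_coeff a 0) - ultra_coeff a (Suc 0) * x"
      by (simp add: algebra_simps)
    show "poly ([:-1, 0, 1:] * ultra (a + 1) (Suc 0)) x = poly (ultra a (Suc 0 + 2)
        - smult (ultra_weight_coeff a (Suc 0)) (ultra a (Suc 0))) x"
      unfolding poly_diff poly_smult poly_mult p using ultra_coeff_weight_eqs(3,4)[OF a]
      by (simp only: One_nat_def ultra.simps poly_pCons poly_0) algebra
  qed
next
  case (ge2 n)
  show ?case
  proof (rule poly_ext)
    fix x
    have 1: "(x * x - 1) * poly (ultra (a + 1) n) x = poly (ultra a (n + 2)) x - ultra_weight_coeff a n * poly (ultra a n) x"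
      and 2: "(x * x - 1) * poly (ultra (a + 1) (n + 1)) x = poly (ultra a (n + 3)) x - ultra_weight_coeff a (n + 1) * poly (ultra a (n + 1)) x"
      using ge2[THEN arg_cong[where f = "\<lambda>p. poly p x"]]
      by (simp_all add: numeral_3_eq_3 algebra_simps)
    have 3: "poly (ultra c (k + 2)) x = x * poly (ultra c (k + 1)) x - ultra_coeff c k * poly (ultra c k) x" for c k
      by simp
    have "(x * x - 1) * poly (ultra (a + 1) (n + 2)) x =
       poly (ultra a (n + 4)) x - ultra_weight_coeff a (n + 2) * poly (ultra a (n + 2)) x"
      using 1 2 3[of a "n + 2"] 3[of "a + 1" "n"] 3[of a n] ultra_coeff_weight_eqs(1,2)[OF a, of n]
      by (simp only: add.assoc one_plus_numeral numeral_plus_numeral numeral_plus_one add_num_simps num.inject) algebra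
    then show "poly ([:-1, 0, 1:] * ultra (a + 1) (Suc (Suc n))) x = poly (ultra a (Suc (Suc n) + 2)
        - smult (ultra_weight_coeff a (Suc (Suc n))) (ultra a (Suc (Suc n)))) x"
      by (simp add: eval_nat_numeral algebra_simps del: ultra.simps)
  qed
qed

section \<open>Half-integer parameters: powers of the weight, factorization, Rodrigues'
  formula\<close>

lemma half_notin_nonpos_Ints: "1 / 2 + of_int k \<notin> (\<int>\<^sub>\<le>\<^sub>0 :: real set)"
proof
  assume "1 / 2 + of_int k \<in> (\<int>\<^sub>\<le>\<^sub>0 :: real set)"
  then obtain n where "1 / 2 + of_int k = (- of_nat n :: real)" by (elim nonpos_Ints_cases')
  then have "of_int (1 + 2 * k + 2 * int n) = (of_int 0 :: real)" by simp
  then show False by (simp only: of_int_eq_iff) presburger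
qed

lemma half_minus_notin_nonpos_Ints: "1 / 2 - real M \<notin> \<int>\<^sub>\<le>\<^sub>0"
  and half_plus_notin_nonpos_Ints: "1 / 2 + real M \<notin> \<int>\<^sub>\<le>\<^sub>0"
  using half_notin_nonpos_Ints[of "- int M"] half_notin_nonpos_Ints[of "int M"] by simp_all

text \<open>For \<open>a = 1/2 - (M + 1)\<close> and \<open>n = 2 * M\<close> the factor
  \<open>n + 2 * a + 1\<close> of \<open>ultra_weight_coeff\<close> vanishes, so raising the degree
  by 2 is just multiplication by \<open>x^2 - 1\<close>.\<close>

lemma ultra_power_weight: "ultra (1 / 2 - real M) (2 * M) = [:-1, 0, 1:] ^ M"
proof (induction M)
  case (Suc M)
  have e: "1 / 2 - real (Suc M) + 1 = 1 / 2 - real M" by simp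
  show ?case
    using ultra_weight[OF half_minus_notin_nonpos_Ints[of "Suc M"], of "2 * M"]
    unfolding e Suc.IH by (simp add: ultra_weight_coeff_def del: ultra.simps mult_pCons_left)
qed simp

lemma ultra_factor: "ultra (1 / 2 - real M) (n + 2 * M) = [:-1, 0, 1:] ^ M * ultra (1 / 2 + real M) n"
proof (induction n rule: induct_nat_012)
  case 0
  show ?case by (simp add: ultra_power_weight)
next
  case 1
  show ?case
  proof (cases M)
    case (Suc N)
    \<comment> \<open>At index \<open>2 * M - 1\<close> the factor \<open>n + 2 * a\<close> is zero.
      The recurrence thus restarts at degree \<open>2 * M\<close>, and degree
      \<open>2 * M + 1\<close> is simply \<open>x\<close> times it.\<close>
    then have "ultra_coeff (1 / 2 - real M) (2 * N + 1) = 0"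
      by (simp add: ultra_coeff_def)
    moreover have "ultra (1 / 2 - real M) (1 + 2 * M) = [:0, 1:] * ultra (1 / 2 - real M) (2 * M)
       - smult (ultra_coeff (1 / 2 - real M) (2 * N + 1)) (ultra (1 / 2 - real M) (2 * N + 1))"
      by (simp add: Suc)
    ultimately show ?thesis by (simp add: ultra_power_weight)
  qed simp
next
  case (ge2 n)
  \<comment> \<open>The shift by \<open>2 * M\<close> carries the denominators for
    \<open>1/2 - M\<close> into those for \<open>1/2 + M\<close>; in the numerator the two factors
    \<open>n + 1\<close> and \<open>n + 2 * M + 1\<close> only change places.\<close>
  have "2 * (real n + 2 * real M + (1 / 2 - real M)) = 2 * (real n + (1 / 2 + real M))"
       "2 * (real n + 2 * real M + (1 / 2 - real M) + 1) = 2 * (real n + (1 / 2 + real M) + 1)"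
    by simp_all
  then have "ultra_coeff (1 / 2 - real M) (n + 2 * M) = ultra_coeff (1 / 2 + real M) n"
    unfolding ultra_coeff_def by (simp add: algebra_simps)
  then show ?case
    using ge2 by (simp add: algebra_simps del: mult_pCons_left mult_pCons_right)
qed

lemma legendre_eq_ultra: "legendre n = smult (fact (2 * n) / (2 ^ n * fact n ^ 2)) (ultra (1 / 2) n)"
  using funpow_pderiv_ultra[OF half_minus_notin_nonpos_Ints[of n], of n n]
  by (simp add: legendre_def ultra_power_weight power2_eq_square mult.assoc flip: mult_2)

section \<open>The explicit Gegenbauer sum as a multiple of \<open>ultra\<close>\<close>

lemma pderiv_gegenbauer:
  "pderiv (gegenbauer a (Suc n)) = smult (2 * a) (gegenbauer (a + 1) n)"
proof -
  define t where "t = (\<lambda>k. smult ((-1) ^ k * pochhammer a (Suc n - k) / (fact k * fact (Suc n - 2 * k)))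
                          ([:0, 2:] ^ (Suc n - 2 * k)))"
  have t: "pderiv (t k) = smult (2 * a) (smult ((-1) ^ k * pochhammer (a + 1) (n - k) / (fact k * fact (n - 2 * k)))
                          ([:0, 2:] ^ (n - 2 * k)))" if "k \<le> n div 2" for k
  proof -
    have "2 * k \<le> n" using that by simp
    then have "Suc n - 2 * k = Suc (n - 2 * k)" "Suc n - k = Suc (n - k)" by simp_all
    then show ?thesis
      by (simp add: t_def pderiv_smult pderiv_power_Suc pderiv_pCons pochhammer_rec mult_ac del: power_Suc of_nat_Suc)
  qed
  \<comment> \<open>For odd \<open>n\<close> the left sum has one further term,
    \<open>k = (n + 1) / 2\<close>. It is a constant polynomial, so its derivative is zero.\<close>
  have "(\<Sum>k\<le>Suc n div 2. pderiv (t k)) = (\<Sum>k\<le>n div 2. pderiv (t k))"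
  proof (rule sum.mono_neutral_right)
    show "\<forall>k\<in>{..Suc n div 2} - {..n div 2}. pderiv (t k) = 0"
    proof
      fix k assume "k \<in> {..Suc n div 2} - {..n div 2}"
      then have "Suc n - 2 * k = 0" by auto
      then show "pderiv (t k) = 0" by (simp add: t_def pderiv_smult)
    qed
  qed auto
  moreover have "gegenbauer a (Suc n) = (\<Sum>k\<le>Suc n div 2. t k)"
    by (simp add: gegenbauer_def t_def)
  ultimately have "pderiv (gegenbauer a (Suc n)) = (\<Sum>k\<le>n div 2. pderiv (t k))"
    by (simp add: higher_pderiv_sum[of 1, simplified])
  then show ?thesis
    by (intro poly_ext) (simp add: gegenbauer_def t poly_sum sum_distrib_left mult.assoc)
qed

lemma gegenbauer_0: "poly (gegenbauer a n) 0 =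
    (if even n then (-1) ^ (n div 2) * pochhammer a (n div 2) / fact (n div 2) else 0)"
proof -
  have "poly (gegenbauer a n) 0 = (\<Sum>k\<le>n div 2. if k = n div 2 \<and> even n
      then (-1) ^ (n div 2) * pochhammer a (n div 2) / fact (n div 2) else 0)"
    unfolding gegenbauer_def poly_sum
  proof (rule sum.cong)
    fix k assume "k \<in> {..n div 2}"
    then have "k \<le> n div 2" by simp
    then have "n - 2 * k = 0 \<longleftrightarrow> k = n div 2 \<and> even n" by presburger
    moreover have "n - n div 2 = n div 2" if "even n" using that by auto
    ultimately show "poly (smult ((- 1) ^ k * pochhammer a (n - k) / (fact k * fact (n - 2 * k))) ([:0, 2:] ^ (n - 2 * k))) 0 =
         (if k = n div 2 \<and> even n then (- 1) ^ (n div 2) * pochhammer a (n div 2) / fact (n div 2) else 0)"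
      by (auto simp: poly_power power_0_left)
  qed simp
  then show ?thesis by simp
qed

lemma ultra_odd_0: "poly (ultra a (Suc (2 * k))) 0 = 0"
  by (induction k) simp_all

text \<open>At 0 the term with \<open>x\<close> drops out, so each even value is
  \<open>- ultra_coeff a (2 * k)\<close> times the preceding one. The prefactor is the expected
  leading coefficient of the Gegenbauer polynomial, and together with it the ratio becomes
  \<open>- (a + k) / (k + 1)\<close>, as in \<open>gegenbauer_0\<close>.\<close>

lemma ultra_even_0:
  assumes a: "a \<notin> \<int>\<^sub>\<le>\<^sub>0"
  shows "2 ^ (2 * k) * pochhammer a (2 * k) / fact (2 * k) * poly (ultra a (2 * k)) 0 = (-1) ^ k * pochhammer a k / fact k"
proof (induction k)
  case (Suc k)
  define y where "y = poly (ultra a (2 * k)) 0"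
  define r where "r = 2 ^ (2 * k) * pochhammer a (2 * k) / fact (2 * k)"
  have nz: "a + 2 * real k \<noteq> 0" "a + 2 * real k + 1 \<noteq> 0"
    using nonpos_Ints_add_nat[OF a, of "2 * k"] nonpos_Ints_add_nat[OF a, of "2 * k + 1"]
    by (auto simp: algebra_simps)
  have "2 ^ (2 * Suc k) * pochhammer a (2 * Suc k) / fact (2 * Suc k) =
     r * (4 * (a + 2 * real k) * (a + 2 * real k + 1) / ((2 * real k + 1) * (2 * real k + 2)))"
    by (simp add: r_def pochhammer_rec' divide_simps add_ac)
  moreover have "poly (ultra a (2 * Suc k)) 0 = - ((2 * real k + 1) * (2 * real k + 2 * a) / (4 * (a + 2 * real k) * (a + 2 * real k + 1))) * y"
    by (simp add: y_def ultra_coeff_def add_ac)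
  ultimately have "2 ^ (2 * Suc k) * pochhammer a (2 * Suc k) / fact (2 * Suc k) * poly (ultra a (2 * Suc k)) 0
    = r * (4 * (a + 2 * real k) * (a + 2 * real k + 1) / ((2 * real k + 1) * (2 * real k + 2))) *
      (- ((2 * real k + 1) * (2 * real k + 2 * a) / (4 * (a + 2 * real k) * (a + 2 * real k + 1))) * y)"
    by (simp only:)
  also have "\<dots> = (r * y) * (- (a + real k) / (real k + 1))"
    using nz by (simp add: divide_simps) algebra
  also have "\<dots> = (-1) ^ k * pochhammer a k / fact k * (- (a + real k) / (real k + 1))"
    using Suc.IH by (simp add: r_def y_def)
  also have "\<dots> = (-1) ^ Suc k * pochhammer a (Suc k) / fact (Suc k)"
    by (simp add: pochhammer_rec' divide_simps) algebra
  finally show ?case .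
qed simp

lemma pderiv_poly_unique:
  fixes p q :: "real poly"
  assumes "pderiv p = pderiv q" "poly p c = poly q c"
  shows "p = q"
proof -
  have "pderiv (p - q) = 0" using assms by (simp add: pderiv_diff)
  then obtain h where "p - q = [:h:]" by (metis pderiv_iszero)
  moreover have "poly (p - q) c = 0" using assms by simp
  ultimately show ?thesis by simp
qed

text \<open>A polynomial is determined by its derivative and its value at 0. Differentiation raises
  the parameter on both sides, hence the induction over all \<open>a\<close>.\<close>

lemma gegenbauer_eq_ultra:
  assumes "a \<notin> \<int>\<^sub>\<le>\<^sub>0"
  shows "gegenbauer a n = smult (2 ^ n * pochhammer a n / fact n) (ultra a n)"
  using assms
proof (induction n arbitrary: a)
  case 0
  show ?case by (simp add: gegenbauer_def)
next
  case (Suc n)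
  show ?case
  proof (rule pderiv_poly_unique)
    show "pderiv (gegenbauer a (Suc n)) = pderiv (smult (2 ^ Suc n * pochhammer a (Suc n) / fact (Suc n)) (ultra a (Suc n)))"
      using Suc.IH[OF nonpos_Ints_add_1[OF Suc.prems]] pderiv_ultra[OF Suc.prems, of n]
      by (simp add: pderiv_gegenbauer pderiv_smult pochhammer_rec mult_ac del: ultra.simps of_nat_Suc)
    show "poly (gegenbauer a (Suc n)) 0 = poly (smult (2 ^ Suc n * pochhammer a (Suc n) / fact (Suc n)) (ultra a (Suc n))) 0"
    proof (cases "even (Suc n)")
      case True
      then obtain k where "Suc n = 2 * k" by blast
      then show ?thesis using ultra_even_0[OF Suc.prems, of k]
        by (simp only: gegenbauer_0 poly_smult) simp
    next
      case False
      then obtain k where "n = 2 * k" by auto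
      then show ?thesis by (simp add: gegenbauer_0 ultra_odd_0 del: ultra.simps)
    qed
  qed
qed

section \<open>Factorial constants and the identification of \<open>J\<close> with
  \<open>ultra\<close>\<close>

lemma pochhammer_half_nat: "2 ^ n * pochhammer (1 / 2) n = (fact (2 * n) / (2 ^ n * fact n) :: real)"
proof -
  have "4 ^ n = (2 ^ n * 2 ^ n :: real)" by (simp flip: power_mult_distrib)
  then show ?thesis
    by (simp add: fact_double[of n] power_mult)
qed

text \<open>The right-hand side is regular at \<open>n = 0\<close>, where it agrees with the value 2
  prescribed in \<open>fact_quot\<close>; from here on the degenerate case needs no separate
  treatment.\<close>

lemma fact_quot_half:
  "2 powi (int n - 1) * fact_quot (int n - 1) (2 * int n - 1) = 2 ^ n * fact n / fact (2 * n)"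
proof (cases n)
  case (Suc k)
  have e: "nat (2 * int (Suc k) - 1) = Suc (2 * k)" by simp
  have "fact (2 * Suc k) = (2 * (real k + 1) * fact (Suc (2 * k)) :: real)"
    by (simp add: algebra_simps)
  then show ?thesis
    unfolding Suc fact_quot_def ifact_def e
    by (simp add: power_int_def divide_simps)
qed (simp add: fact_quot_def power_int_def)

lemma J_const_eq:
  "J_const (int M - 1) (q + 2 * M) = fact q * (2 ^ (q + M) * fact (q + M) / fact (2 * (q + M)))"
proof -
  have "J_const (int M - 1) (q + 2 * M) = fact q *
     (2 powi (int (q + M) - 1) * fact_quot (int (q + M) - 1) (2 * int (q + M) - 1))"
  proof -
    have "int (q + 2 * M) - (int M - 1) - 2 = int (q + M) - 1"
      "2 * int (q + 2 * M) - 2 * (int M - 1) - 3 = 2 * int (q + M) - 1"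
      "int (q + 2 * M) - 2 * (int M - 1) - 2 = int q" by simp_all
    then show ?thesis unfolding J_const_def ifact_def by (simp add: add_ac)
  qed
  then show ?thesis by (simp only: fact_quot_half)
qed

text \<open>With \<open>N = q + M\<close>, the Legendre normalization and the \<open>M\<close>
  derivatives contribute \<open>(2N)! / (2^N N! q!)\<close>, and \<open>J_const\<close> is the
  reciprocal of this.\<close>

lemma J_lower_eq_ultra: "J_lower (int M - 1) q = ultra (1 / 2 + real M) q"
proof -
  have e: "nat (int q + 2 * (int M - 1) + 2) = q + 2 * M" "nat (int M - 1 + 1) = M"
      "nat (int q + (int M - 1) + 1) = q + M" by auto
  have s: "(pderiv ^^ k) (smult c p) = smult c ((pderiv ^^ k) p)" for c k and p :: "real poly"
    by (induction k) (simp_all add: pderiv_smult)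
  have "1 / 2 \<notin> (\<int>\<^sub>\<le>\<^sub>0 :: real set)" using half_plus_notin_nonpos_Ints[of 0] by simp
  note d = funpow_pderiv_ultra[OF this, of M q]
  show ?thesis
    unfolding J_lower_def e J_const_eq
    by (simp add: legendre_eq_ultra s d power2_eq_square add.commute[of _ "1 / 2"])
qed

text \<open>The parameter is \<open>1/2 + M\<close> with \<open>M = - m - 1\<close> if
  \<open>m \<le> -2\<close>, and \<open>1/2 - M\<close> with \<open>M = m + 1\<close> otherwise; in
  the second case \<open>ultra_factor\<close> absorbs the power of \<open>x^2 - 1\<close>.\<close>

lemma J_explicit_eq_ultra:
  assumes "J_explicit_index m p"
  shows "J m p = ultra (- of_int m - 1 / 2) p"
proof (cases "m \<le> -2")
  case True
  define M where "M = nat (- m - 1)"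
  have m: "m = - int M - 1" using True by (simp add: M_def)
  have "J m p = J_lower (int M - 1) p" using True m by (simp add: J_def)
  then show ?thesis by (simp only: J_lower_eq_ultra) (simp add: m)
next
  case False
  define M where "M = nat (m + 1)"
  define q where "q = nat (int p - 2 * m - 2)"
  have m: "m = int M - 1" using False by (simp add: M_def)
  have p: "p = q + 2 * M" using False assms by (auto simp: q_def M_def J_explicit_index_def)
  have i: "2 * m + 2 \<le> int p"
    using p m by simp
  have "J m p = [:-1, 0, 1:] ^ M * J_lower (int M - 1) q"
    using J_upper_factor[of m p] False i by (simp add: J_def q_def M_def)
  also have "\<dots> = ultra (1 / 2 - real M) p"
    by (simp add: J_lower_eq_ultra ultra_factor p)
  finally show ?thesis by (simp add: m)
qed

lemma J_rec_eq_ultra: "J_rec m p = ultra (- of_int m - 1 / 2) p"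
proof (induction p rule: induct_nat_012)
  case (ge2 n)
  have "rec_coeff m (Suc (Suc n)) = ultra_coeff (- of_int m - 1 / 2) n"
  proof -
    have "4 * (real n + (- of_int m - 1 / 2)) * (real n + (- of_int m - 1 / 2) + 1)
       = (2 * real n + 1 - 2 * of_int m) * (2 * real n - 1 - 2 * of_int m)" by algebra
    then show ?thesis unfolding rec_coeff_def ultra_coeff_def
      by (simp add: algebra_simps)
  qed
  then show ?case using ge2 by simp
qed simp_all

text \<open>This includes the degrees at which \<open>J\<close> falls back on \<open>J_rec\<close>,
  so the claims below can be read off from \<open>ultra\<close> without distinguishing
  ranges.\<close>

lemma J_eq_ultra: "J m p = ultra (- of_int m - 1 / 2) p"
  using J_explicit_eq_ultra[of m p] J_rec_eq_ultra[of m p]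
  by (cases "J_explicit_index m p") (auto simp: J_def J_explicit_index_def)

section \<open>Integration by parts, orthogonality and norms\<close>

definition poly_integral :: "real poly \<Rightarrow> real" where
  "poly_integral p = integral {-1..1} (poly p)"

lemma poly_integrable: "poly p integrable_on {a..b :: real}"
  by (intro integrable_continuous_real continuous_intros)

lemma poly_integral_diff: "poly_integral (p - q) = poly_integral p - poly_integral q"
proof -
  have "poly (p - q) = (\<lambda>x. poly p x - poly q x)" by auto
  then show ?thesis
    by (simp add: poly_integral_def integral_diff poly_integrable)
qed

lemma poly_integral_smult: "poly_integral (smult c p) = c * poly_integral p"
proof -
  have "poly (smult c p) = (\<lambda>x. c * poly p x)" by auto
  then show ?thesis by (simp add: poly_integral_def)
qed

lemma has_integral_pderiv:
  assumes "a \<le> b"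
  shows "(poly (pderiv p) has_integral (poly p b - poly p a)) {a..b :: real}"
  using assms by (intro fundamental_theorem_of_calculus)
    (auto simp: has_real_derivative_iff_has_vector_derivative[symmetric] intro: DERIV_subset[OF poly_DERIV])

lemma poly_integral_pderiv: "poly_integral (pderiv p) = poly p 1 - poly p (-1)"
  unfolding poly_integral_def using has_integral_pderiv[of "-1" 1 p] by (simp add: integral_unique)

lemma poly_integral_by_parts:
  assumes "poly p 1 = 0" "poly p (-1) = 0"
  shows "poly_integral (pderiv p * q) = - poly_integral (p * pderiv q)"
proof -
  have "pderiv (p * q) = pderiv p * q - smult (-1) (p * pderiv q)"
    by (simp add: pderiv_mult mult.commute)
  then show ?thesis
    using poly_integral_pderiv[of "p * q"] assms
    by (simp add: poly_integral_diff poly_integral_smult del: smult_minus_left)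
qed

lemma ultra_minus_boundary:
  assumes "n \<ge> 2 * M" "M > 0"
  shows "poly (ultra (1 / 2 - real M) n) 1 = 0" "poly (ultra (1 / 2 - real M) n) (-1) = 0"
  using ultra_factor[of M "n - 2 * M"] assms by (simp_all add: poly_power)

text \<open>Up to a factor, the left polynomial is the derivative of \<open>?u\<close>, which
  vanishes at both endpoints because it contains \<open>(x^2 - 1)^(M + 1)\<close>. The truncated
  \<open>b - 1\<close> is harmless at \<open>b = 0\<close>, where the factor \<open>real b\<close>
  is zero.\<close>

lemma ultra_integral_step:
  "(real n + 2 * real M + 2) * poly_integral (ultra (1 / 2 - real M) (Suc n + 2 * M) * ultra (1 / 2 + real M) b) =
   - real b * poly_integral (ultra (1 / 2 - real (Suc M)) (n + 2 * Suc M) * ultra (1 / 2 + real (Suc M)) (b - 1))"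
proof -
  let ?u = "ultra (1 / 2 - real (Suc M)) (n + 2 * Suc M)" and ?v = "ultra (1 / 2 + real M) b"
  have u: "pderiv ?u = smult (real n + 2 * real M + 2) (ultra (1 / 2 - real M) (Suc n + 2 * M))"
    using pderiv_ultra[OF half_minus_notin_nonpos_Ints[of "Suc M"], of "Suc n + 2 * M"]
    by (simp del: ultra.simps add: algebra_simps)
  have v: "pderiv ?v = smult (real b) (ultra (1 / 2 + real (Suc M)) (b - 1))"
    using pderiv_ultra[OF half_plus_notin_nonpos_Ints[of M], of "b - 1"]
    by (cases b) (simp_all del: ultra.simps(2,3) add: algebra_simps)
  have "poly_integral (pderiv ?u * ?v) = - poly_integral (?u * pderiv ?v)"
    by (intro poly_integral_by_parts ultra_minus_boundary) simp_all
  then show ?thesis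
    unfolding u v by (simp add: poly_integral_smult del: ultra.simps)
qed

text \<open>Each integration by parts lowers both degrees by one, so \<open>b\<close> reaches 0
  while the other degree index is still positive; one more step then gives zero.\<close>

lemma ultra_orthogonal:
  assumes "b < n"
  shows "poly_integral (ultra (1 / 2 - real M) (n + 2 * M) * ultra (1 / 2 + real M) b) = 0"
  using assms
proof (induction b arbitrary: n M)
  case 0
  then obtain k where "n = Suc k" by (cases n) auto
  then show ?case using ultra_integral_step[of k M 0]
    by (simp add: add_nonneg_eq_0_iff del: ultra.simps(2,3) add: add.commute)
next
  case (Suc b)
  then obtain k where k: "n = Suc k" by (cases n) auto
  have "poly_integral (ultra (1 / 2 - real (Suc M)) (k + 2 * Suc M) * ultra (1 / 2 + real (Suc M)) b) = 0"
    using Suc k by (intro Suc.IH) simp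
  with ultra_integral_step[of k M "Suc b"] have "(real k + 2 * real M + 2) *
     poly_integral (ultra (1 / 2 - real M) (Suc k + 2 * M) * ultra (1 / 2 + real M) (Suc b)) = 0"
    by simp
  moreover have "real k + 2 * real M + 2 > 0" by simp
  ultimately show ?case unfolding k by (metis less_irrefl mult_eq_0_iff)
qed

text \<open>Contiguity writes \<open>(x^2 - 1)^(M + 1)\<close> as
  \<open>ultra (1/2 - M) (2 * M + 2)\<close> minus a multiple of \<open>(x^2 - 1)^M\<close>. The
  first term is orthogonal to constants, which leaves a one-step recursion. The closed form is
  arranged to be the case \<open>n = 0\<close> of \<open>ultra_norm\<close>.\<close>

lemma poly_integral_power_weight:
  "poly_integral ([:-1, 0, 1:] ^ M) = (-1) ^ M * 2 * (2 ^ M * fact M / fact (2 * M))\<^sup>2 * fact (2 * M) / (2 * real M + 1)"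
proof (induction M)
  case 0
  have "poly (1 :: real poly) = (\<lambda>x. 1)" by auto
  then show ?case by (simp add: poly_integral_def)
next
  case (Suc M)
  have e: "1 / 2 - real (Suc M) + 1 = 1 / 2 - real M" by simp
  have 0: "poly_integral (ultra (1 / 2 - real M) (2 + 2 * M)) = 0"
    using ultra_orthogonal[of 0 2 M] by simp
  have "poly_integral ([:-1, 0, 1:] ^ Suc M) = poly_integral (ultra (1 / 2 - real (Suc M)) (2 * M + 2))"
    using ultra_power_weight[of "Suc M"] by simp
  also have "\<dots> = - ultra_raise_coeff (1 / 2 - real (Suc M)) (2 * M) * poly_integral ([:-1, 0, 1:] ^ M)"
    unfolding ultra_raise[OF half_minus_notin_nonpos_Ints[of "Suc M"]] e ultra_power_weight
    using 0 by (simp add: poly_integral_diff poly_integral_smult add.commute del: ultra.simps add_2_eq_Suc add_2_eq_Suc')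
  also have "ultra_raise_coeff (1 / 2 - real (Suc M)) (2 * M) = 2 * (real M + 1) / (2 * real M + 3)"
    by (simp add: ultra_raise_coeff_def divide_simps) algebra
  finally have 1: "poly_integral ([:-1, 0, 1:] ^ Suc M) =
     - (2 * (real M + 1) / (2 * real M + 3)) * poly_integral ([:-1, 0, 1:] ^ M)" .
  have D: "2 ^ Suc M * fact (Suc M) / fact (2 * Suc M) = (2 ^ M * fact M / fact (2 * M)) / (2 * real M + 1)"
    by (simp add: divide_simps) algebra
  have F: "fact (2 * Suc M) = (2 * real M + 1) * (2 * real M + 2) * fact (2 * M)"
    by (simp add: algebra_simps)
  show ?case
    unfolding 1 Suc.IH D F by (simp add: divide_simps power2_eq_square) algebra
qed

lemma ultra_norm:
  "poly_integral (ultra (1 / 2 - real M) (n + 2 * M) * ultra (1 / 2 + real M) n) =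
    (-1) ^ M * 2 * (2 ^ (n + M) * fact (n + M) / fact (2 * (n + M)))\<^sup>2 * fact n * fact (n + 2 * M) / (2 * real (n + M) + 1)"
proof (induction n arbitrary: M)
  case 0
  show ?case by (simp add: ultra_power_weight poly_integral_power_weight)
next
  case (Suc n)
  \<comment> \<open>\<open>D\<close> depends on \<open>n\<close> and \<open>M\<close> only through
    their sum, which integration by parts preserves; only the sign and the two factorials outside
    \<open>D\<close> change.\<close>
  define D where "D = 2 * (2 ^ (Suc n + M) * fact (Suc n + M) / fact (2 * (Suc n + M)) :: real)\<^sup>2 / (2 * real (Suc n + M) + 1)"
  have IH: "poly_integral (ultra (1 / 2 - real (Suc M)) (n + 2 * Suc M) * ultra (1 / 2 + real (Suc M)) n) =
      (-1) ^ Suc M * fact n * fact (n + 2 * Suc M) * D"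
    unfolding Suc.IH D_def by (simp del: fact_Suc)
  have f: "fact (n + 2 * Suc M) = (real n + 2 * real M + 2) * fact (Suc n + 2 * M)"
     "fact (Suc n) = (real n + 1) * fact n"
    by (simp_all add: algebra_simps)
  define X where "X = poly_integral (ultra (1 / 2 - real M) (Suc n + 2 * M) * ultra (1 / 2 + real M) (Suc n))"
  have "(real n + 2 * real M + 2) * X
      = (real n + 2 * real M + 2) * ((-1) ^ M * fact (Suc n) * fact (Suc n + 2 * M) * D)"
    using ultra_integral_step[of n M "Suc n"] unfolding X_def diff_Suc_1 IH f
    by (simp add: algebra_simps del: fact_Suc ultra.simps)
  moreover have "real n + 2 * real M + 2 > 0" by simp
  ultimately have "X = (-1) ^ M * fact (Suc n) * fact (Suc n + 2 * M) * D"
    by (metis less_irrefl mult_left_cancel)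
  then show ?case
    unfolding X_def D_def by (simp del: fact_Suc ultra.simps)
qed

section \<open>The claims for \<open>J\<close>\<close>

lemma J_minus_eq_ultra: "J (int M - 1) p = ultra (1 / 2 - real M) p"
  by (simp add: J_eq_ultra)

lemma J_boundary:
  assumes "m \<ge> 0" "int p \<ge> 2 * m + 2"
  shows "poly (J m p) 1 = 0" "poly (J m p) (-1) = 0"
proof -
  define M where "M = nat (m + 1)"
  have M: "m = int M - 1" using assms by (simp add: M_def)
  show "poly (J m p) 1 = 0" "poly (J m p) (-1) = 0"
    unfolding M J_minus_eq_ultra using assms M by (auto intro!: ultra_minus_boundary)
qed

lemma J_index_notin_nonpos_Ints: "- real_of_int m - 1 / 2 \<notin> \<int>\<^sub>\<le>\<^sub>0"
proof -
  have "- real_of_int m - 1 / 2 = 1 / 2 + of_int (- m - 1)" by simp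
  then show ?thesis by (simp only: half_notin_nonpos_Ints not_False_eq_True)
qed

lemma pderiv_J: "pderiv (J m (Suc p)) = smult (real (Suc p)) (J (m - 1) p)"
  using pderiv_ultra[OF J_index_notin_nonpos_Ints[of m], of p]
  by (simp add: J_eq_ultra del: ultra.simps of_nat_Suc)

lemma funpow_pderiv_J: "(pderiv ^^ k) (J m (p + k)) = smult (fact (p + k) / fact p) (J (m - int k) p)"
  using funpow_pderiv_ultra[OF J_index_notin_nonpos_Ints[of m], of k p]
  by (simp add: J_eq_ultra algebra_simps)

text \<open>Lowering superscript and degree by \<open>k\<close> keeps the superscript nonnegative
  and the degree large enough, since \<open>p - k \<ge> 2 * (m - k) + 2\<close>. So the derivative
  is a multiple of another \<open>J\<close> vanishing at the endpoints.\<close>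

lemma J_funpow_pderiv_boundary:
  assumes "int p \<ge> 2 * m + 2" "int k \<le> m"
  shows "poly ((pderiv ^^ k) (J m p)) 1 = 0 \<and> poly ((pderiv ^^ k) (J m p)) (-1) = 0"
proof -
  obtain q where p: "p = q + k" using assms le_Suc_ex[of k p] by (auto simp: add.commute)
  show ?thesis
    unfolding p funpow_pderiv_J using J_boundary[of "m - int k" q] assms p by simp
qed

lemma J_eq_integral:
  assumes "m \<ge> 0" "int p \<ge> 2 * m + 2" "-1 \<le> x"
  shows "poly (J m p) x = real p * integral {-1..x} (poly (J (m - 1) (p - 1)))"
proof -
  obtain q where p: "p = Suc q" using assms by (cases p) auto
  have "integral {-1..x} (poly (pderiv (J m p))) = poly (J m p) x"
    using has_integral_pderiv[OF assms(3), of "J m p"] J_boundary(2)[OF assms(1,2)]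
    by (simp add: integral_unique)
  moreover have "poly (pderiv (J m p)) = (\<lambda>x. real p * poly (J (m - 1) (p - 1)) x)"
    by (auto simp: p pderiv_J)
  ultimately show ?thesis by simp
qed

lemma J_raise:
  assumes "p \<ge> 2"
  shows "J m p = J (m - 1) p
          - smult (of_int (int p * (int p - 1))
                   / of_int ((2 * int p - 2 * m - 1) * (2 * int p - 2 * m - 3)))
                  (J (m - 1) (p - 2))"
proof -
  obtain n where p: "p = n + 2" using assms le_Suc_ex[of 2 p] by (auto simp: add.commute)
  let ?a = "- real_of_int m - 1 / 2"
  have "4 * (real n + ?a + 1) * (real n + ?a + 2) = (2 * real n - 2 * of_int m + 3) * (2 * real n - 2 * of_int m + 1)"
    by algebra
  then have c: "ultra_raise_coeff ?a n = of_int (int p * (int p - 1))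
                   / of_int ((2 * int p - 2 * m - 1) * (2 * int p - 2 * m - 3))"
    unfolding ultra_raise_coeff_def p by (simp add: algebra_simps)
  have a: "- real_of_int (m - 1) - 1 / 2 = ?a + 1" by simp
  show ?thesis
    unfolding J_eq_ultra c[symmetric] a
    using ultra_raise[OF J_index_notin_nonpos_Ints[of m], of n] unfolding p by simp
qed

text \<open>The constant is \<open>p! / (2^p (1/2 + M)_p)\<close> in Pochhammer notation, the
  reciprocal of the leading coefficient of the Gegenbauer polynomial. Both factorial quotients
  become Pochhammer symbols at 1/2, and splitting the one of length \<open>p + M\<close> after
  \<open>M\<close> factors leaves the symbol at \<open>1/2 + M\<close>.\<close>

lemma J_eq_gegenbauer:
  "J (- int M - 1) p =
     smult (ifact (2 * int M) * fact p * 2 powi (int p - 1)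
               * fact_quot (int p + int M - 1) (2 * int p + 2 * int M - 1) / ifact (int M))
              (gegenbauer (1 / 2 + real M) p)"
proof -
  let ?a = "1 / 2 + real M"
  have D: "2 powi (int p - 1) * fact_quot (int p + int M - 1) (2 * int p + 2 * int M - 1)
    = 1 / (2 ^ M * (2 ^ (p + M) * pochhammer (1 / 2) (p + M)))"
  proof -
    have "2 powi (int (p + M) - 1) = 2 ^ M * (2 powi (int p - 1) :: real)"
      by (simp add: power_int_diff power_int_add)
    moreover have "int (p + M) - 1 = int p + int M - 1" "2 * int (p + M) - 1 = 2 * int p + 2 * int M - 1"
      by simp_all
    ultimately have "2 ^ M * (2 powi (int p - 1) * fact_quot (int p + int M - 1) (2 * int p + 2 * int M - 1)) =
        2 ^ (p + M) * fact (p + M) / fact (2 * (p + M))"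
      using fact_quot_half[of "p + M"] by (simp only: mult.assoc)
    then show ?thesis
      by (simp add: pochhammer_half_nat divide_simps mult_ac del: of_nat_add)
  qed
  have q: "ifact (2 * int M) / ifact (int M) = 2 ^ M * (2 ^ M * pochhammer (1 / 2) M)"
    by (simp add: ifact_def nat_mult_distrib pochhammer_half_nat)
  have pos: "pochhammer (1 / 2 :: real) M > 0" "pochhammer ?a p > 0"
    by (simp_all add: pochhammer_pos)
  have pp: "pochhammer (1 / 2) (p + M) = pochhammer (1 / 2 :: real) M * pochhammer ?a p"
    using pochhammer_product'[of "1 / 2 :: real" M p] by (simp add: add.commute)
  have "ifact (2 * int M) * fact p * 2 powi (int p - 1)
               * fact_quot (int p + int M - 1) (2 * int p + 2 * int M - 1) / ifact (int M)
     = (ifact (2 * int M) / ifact (int M)) * fact p * (2 powi (int p - 1) * fact_quot (int p + int M - 1) (2 * int p + 2 * int M - 1))"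
    by simp
  also have "\<dots> = fact p / (2 ^ p * pochhammer ?a p)"
    unfolding D q pp using pos by (simp add: divide_simps power_add)
  finally have "ifact (2 * int M) * fact p * 2 powi (int p - 1)
               * fact_quot (int p + int M - 1) (2 * int p + 2 * int M - 1) / ifact (int M)
     = fact p / (2 ^ p * pochhammer ?a p)" .
  then show ?thesis
    using pos gegenbauer_eq_ultra[OF half_plus_notin_nonpos_Ints[of M], of p]
    by (simp add: J_eq_ultra)
qed

text \<open>Factoring only the second polynomial cancels the weight up to the sign
  \<open>(-1)^M\<close> and leaves a polynomial integrand.\<close>

lemma J_integral:
  "((\<lambda>x. poly (J (int M - 1) (n + 2 * M)) x * poly (J (int M - 1) (k + 2 * M)) x / (1 - x\<^sup>2) ^ M)
     has_integral ((-1) ^ M * poly_integral (ultra (1 / 2 - real M) (n + 2 * M) * ultra (1 / 2 + real M) k))) {-1..1}"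
proof -
  let ?p = "ultra (1 / 2 - real M) (n + 2 * M) * ultra (1 / 2 + real M) k"
  have "(poly ?p has_integral poly_integral ?p) {-1..1}"
    unfolding poly_integral_def using poly_integrable by (rule integrable_integral)
  then have "((\<lambda>x. (-1) ^ M * poly ?p x) has_integral (-1) ^ M * poly_integral ?p) {-1..1}"
    by (rule has_integral_mult_right)
  moreover have "(-1) ^ M * poly ?p x =
      poly (J (int M - 1) (n + 2 * M)) x * poly (J (int M - 1) (k + 2 * M)) x / (1 - x\<^sup>2) ^ M" for x
  proof -
    \<comment> \<open>The identity also covers \<open>w ^ M = 0\<close>, that is, the endpoints for
      positive \<open>M\<close>: division by zero gives 0 on the right, and the left side vanishes
      as well.\<close>
    have "(-1) ^ M * ((- w) ^ M * c * d) = (- w) ^ M * c * ((- w) ^ M * d) / w ^ M" for w c d :: real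
    proof -
      have "(-1) ^ M * (-1) ^ M = (1 :: real)" by (simp flip: power_mult_distrib)
      then show ?thesis
        unfolding power_minus[of w] by (cases "w ^ M = 0") (simp_all add: divide_simps del: power_eq_0_iff)
    qed
    moreover have "poly [:-1, 0, 1:] x = - (1 - x\<^sup>2)" by (simp add: power2_eq_square)
    ultimately show ?thesis
      unfolding J_minus_eq_ultra ultra_factor poly_mult poly_power by (simp only:)
  qed
  ultimately show ?thesis by simp
qed

lemma J_inner_product:
  fixes m :: int
  assumes "m \<ge> -1" "int p \<ge> 2 * m + 2" "int q \<ge> 2 * m + 2"
  shows "((\<lambda>\<mu>. poly (J m p) \<mu> * poly (J m q) \<mu> / (1 - \<mu>\<^sup>2) ^ nat (m + 1)) has_integral
          (if p \<noteq> q then 0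
           else 2 powi (2 * int p - 2 * m - 3)
                * (fact_quot (int p - m - 2) (2 * int p - 2 * m - 3))\<^sup>2
                * ifact (int p - 2 * m - 2) * fact p / of_int (2 * int p - 2 * m - 1)))
          {-1..1}"
proof -
  define M where "M = nat (m + 1)"
  have m: "m = int M - 1" and M': "nat (m + 1) = M" using assms(1) by (simp_all add: M_def)
  obtain n where p: "p = n + 2 * M" using assms m le_Suc_ex[of "2 * M" p] by (auto simp: add.commute)
  obtain k where q: "q = k + 2 * M" using assms m le_Suc_ex[of "2 * M" q] by (auto simp: add.commute)
  \<comment> \<open>\<open>ultra_orthogonal\<close> needs the factored polynomial to be the one of
    smaller degree, so the roles are exchanged when \<open>n < k\<close>.\<close>
  consider "n < k" | "k < n" | "n = k" by linarith
  then show ?thesis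
  proof cases
    case 1
    then show ?thesis
      using J_integral[of M k n] ultra_orthogonal[of n k M] unfolding M' m p q
      by (simp add: mult.commute)
  next
    case 2
    then show ?thesis
      using J_integral[of M n k] ultra_orthogonal[of k n M] unfolding M' m p q
      by simp
  next
    case 3
    define N where "N = n + M"
    have e: "2 * int p - 2 * m - 3 = 2 * int N - 1" "int p - m - 2 = int N - 1"
      "int p - 2 * m - 2 = int n" "2 * int p - 2 * m - 1 = 2 * int N + 1"
      by (simp_all add: m p N_def)
    \<comment> \<open>Half of the power of 2 goes with each copy of \<open>fact_quot\<close>, so
      that \<open>fact_quot_half\<close> applies to the square, including
      \<open>N = 0\<close>.\<close>
    have "2 powi (2 * int N - 1) = 2 * ((2 powi (int N - 1))\<^sup>2 :: real)"
      by (simp add: power_int_diff power_int_mult power2_eq_square flip: power_mult_distrib)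
    then have "2 powi (2 * int N - 1) * (fact_quot (int N - 1) (2 * int N - 1))\<^sup>2 =
        2 * (2 ^ N * fact N / fact (2 * N))\<^sup>2"
      by (simp only: fact_quot_half[symmetric] power_mult_distrib mult.assoc)
    moreover have "(-1) ^ M * (-1) ^ M = (1 :: real)" by (simp flip: power_mult_distrib)
    moreover have "((\<lambda>\<mu>. poly (J m p) \<mu> * poly (J m q) \<mu> / (1 - \<mu>\<^sup>2) ^ M) has_integral
       (-1) ^ M * ((-1) ^ M * 2 * (2 ^ N * fact N / fact (2 * N))\<^sup>2 * fact n * fact p / (2 * real N + 1))) {-1..1}"
      using J_integral[of M n n] 3 unfolding ultra_norm m p q N_def by simp
    ultimately show ?thesis
      using 3 unfolding e M' by (simp add: p q ifact_def mult.assoc[symmetric])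
  qed
qed

theorem theorem2p2:
  shows
    "(\<forall>(m::int) (p::nat). m \<ge> -1 \<longrightarrow> int p \<ge> 2 * m + 2 \<longrightarrow>
        (\<forall>k::nat. int k \<le> m \<longrightarrow>
           poly ((pderiv ^^ k) (J m p)) 1 = 0 \<and> poly ((pderiv ^^ k) (J m p)) (-1) = 0))
   \<and> (\<forall>(m::int) (p::nat). m \<ge> 0 \<longrightarrow> int p \<ge> 2 * m + 2 \<longrightarrow>
        pderiv (J (- m - 1) (nat (int p - 2 * m - 1))) =
        smult (of_int (int p - 2 * m - 1)) (J (- m - 2) (nat (int p - 2 * m - 2))))
   \<and> (\<forall>(m::int) (p::nat) (\<mu>::real). m \<ge> 0 \<longrightarrow> int p \<ge> 2 * m + 2 \<longrightarrow> \<mu> \<in> {-1..1} \<longrightarrow>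
        (\<lambda>s. poly (J (m - 1) (p - 1)) s) integrable_on {-1..\<mu>} \<and>
        poly (J m p) \<mu> = real p * integral {-1..\<mu>} (\<lambda>s. poly (J (m - 1) (p - 1)) s))
   \<and> (\<forall>(m::int) (p::nat). m \<ge> 0 \<longrightarrow> int p \<ge> 2 * m + 2 \<longrightarrow>
        J m p = J (m - 1) p
          - smult (of_int (int p * (int p - 1))
                   / of_int ((2 * int p - 2 * m - 1) * (2 * int p - 2 * m - 3)))
                  (J (m - 1) (p - 2)))
   \<and> (\<forall>(m::int) (p::nat) (\<alpha>::real). m \<ge> -1 \<longrightarrow> 2 * \<alpha> = of_int (2 * m + 3) \<longrightarrow>
        \<comment> \<open>the factorial arguments are \<open>2\<alpha>-1 = 2m+2\<close>, \<open>(2p+2\<alpha>-3)/2 = p+m\<close>,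
            \<open>2p+2\<alpha>-2 = 2p+2m+1\<close>, \<open>(2\<alpha>-1)/2 = m+1\<close>\<close>
        J (- m - 2) p =
        smult (ifact (2 * m + 2) * fact p * 2 powi (int p - 1)
               * fact_quot (int p + m) (2 * int p + 2 * m + 1) / ifact (m + 1))
              (gegenbauer \<alpha> p))
   \<and> (\<forall>m::int.
        J m 0 = 1 \<and> J m 1 = [:0, 1:] \<and>
        (\<forall>p::nat. p \<ge> 2 \<longrightarrow>
           J m p = [:0, 1:] * J m (p - 1)
             - smult (of_int ((int p - 1) * (int p - 2 * m - 3))
                      / of_int ((2 * int p - 2 * m - 3) * (2 * int p - 2 * m - 5)))
                     (J m (p - 2))) \<and>
        (\<forall>p::nat. J_explicit_index m p \<longrightarrow> J_rec m p = J m p))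
   \<and> (\<forall>(m::int) (p::nat) (q::nat). m \<ge> -1 \<longrightarrow> int p \<ge> 2 * m + 2 \<longrightarrow> int q \<ge> 2 * m + 2 \<longrightarrow>
        ((\<lambda>\<mu>. poly (J m p) \<mu> * poly (J m q) \<mu> / (1 - \<mu>\<^sup>2) ^ nat (m + 1)) has_integral
          (if p \<noteq> q then 0
           else 2 powi (2 * int p - 2 * m - 3)
                * (fact_quot (int p - m - 2) (2 * int p - 2 * m - 3))\<^sup>2
                * ifact (int p - 2 * m - 2) * fact p / of_int (2 * int p - 2 * m - 1)))
          {-1..1})"
proof (intro conjI allI impI)
  fix m :: int and p k :: nat
  assume "m \<ge> -1" "int p \<ge> 2 * m + 2" "int k \<le> m"
  then show "poly ((pderiv ^^ k) (J m p)) 1 = 0" "poly ((pderiv ^^ k) (J m p)) (-1) = 0"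
    using J_funpow_pderiv_boundary by simp_all
next
  fix m :: int and p :: nat
  assume "m \<ge> 0" "int p \<ge> 2 * m + 2"
  then have "nat (int p - 2 * m - 1) = Suc (nat (int p - 2 * m - 2))"
    "of_int (int p - 2 * m - 1) = real (nat (int p - 2 * m - 1))" by simp_all
  moreover have "- m - 2 = - m - 1 - 1" by simp
  ultimately show "pderiv (J (- m - 1) (nat (int p - 2 * m - 1))) =
        smult (of_int (int p - 2 * m - 1)) (J (- m - 2) (nat (int p - 2 * m - 2)))"
    by (simp only: pderiv_J)
next
  fix m :: int and p :: nat and \<mu> :: real
  assume "m \<ge> 0" "int p \<ge> 2 * m + 2" "\<mu> \<in> {-1..1}"
  then show "(\<lambda>s. poly (J (m - 1) (p - 1)) s) integrable_on {-1..\<mu>}"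
    and "poly (J m p) \<mu> = real p * integral {-1..\<mu>} (\<lambda>s. poly (J (m - 1) (p - 1)) s)"
    using poly_integrable J_eq_integral by simp_all
next
  fix m :: int and p :: nat
  assume "m \<ge> 0" "int p \<ge> 2 * m + 2"
  then show "J m p = J (m - 1) p
          - smult (of_int (int p * (int p - 1))
                   / of_int ((2 * int p - 2 * m - 1) * (2 * int p - 2 * m - 3)))
                  (J (m - 1) (p - 2))"
    by (intro J_raise) simp
next
  fix m :: int and p :: nat and \<alpha> :: real
  assume m: "m \<ge> -1" and a: "2 * \<alpha> = of_int (2 * m + 3)"
  define M where "M = nat (m + 1)"
  have m': "m = int M - 1" using m by (simp add: M_def)
  have "\<alpha> = 1 / 2 + real M" using a m' by simp
  moreover have "- m - 2 = - int M - 1" "2 * m + 2 = 2 * int M" "int p + m = int p + int M - 1"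
     "2 * int p + 2 * m + 1 = 2 * int p + 2 * int M - 1" "m + 1 = int M"
    using m' by simp_all
  ultimately show "J (- m - 2) p =
        smult (ifact (2 * m + 2) * fact p * 2 powi (int p - 1)
               * fact_quot (int p + m) (2 * int p + 2 * m + 1) / ifact (m + 1))
              (gegenbauer \<alpha> p)"
    by (simp only: J_eq_gegenbauer)
next
  fix m :: int
  show "J m 0 = 1" "J m 1 = [:0, 1:]"
    by (simp_all add: J_eq_ultra)
  show "J m p = [:0, 1:] * J m (p - 1)
             - smult (of_int ((int p - 1) * (int p - 2 * m - 3))
                      / of_int ((2 * int p - 2 * m - 3) * (2 * int p - 2 * m - 5)))
                     (J m (p - 2))" if "p \<ge> 2" for p
  proof -
    obtain n where p: "p = Suc (Suc n)" using \<open>p \<ge> 2\<close> by (metis add_2_eq_Suc le_Suc_ex)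
    have "J m p = [:0, 1:] * J m (p - 1) - smult (rec_coeff m p) (J m (p - 2))"
      unfolding J_eq_ultra J_rec_eq_ultra[symmetric] by (simp add: p)
    then show ?thesis by (simp only: rec_coeff_def)
  qed
  show "J_rec m p = J m p" for p
    by (simp add: J_eq_ultra J_rec_eq_ultra)
next
  fix m :: int and p q :: nat
  assume "m \<ge> -1" "int p \<ge> 2 * m + 2" "int q \<ge> 2 * m + 2"
  then show "((\<lambda>\<mu>. poly (J m p) \<mu> * poly (J m q) \<mu> / (1 - \<mu>\<^sup>2) ^ nat (m + 1)) has_integral
          (if p \<noteq> q then 0
           else 2 powi (2 * int p - 2 * m - 3)
                * (fact_quot (int p - m - 2) (2 * int p - 2 * m - 3))\<^sup>2
                * ifact (int p - 2 * m - 2) * fact p / of_int (2 * int p - 2 * m - 1)))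
          {-1..1}"
    by (rule J_inner_product)
qed

end
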